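(* Let $A_0\in\mathbb{R}^{n\times n}$, $B\in\mathbb{R}^{n\times m}$ and $C_p\in\mathbb{R}^{n^2\times n^2}$ be given. If there exist $K\in\mathbb{R}^{m\times n}$ and $\alpha\in(0,1)$ such that $$\begin{bmatrix}(\alpha-\sigma_{max}(C_p))I & (A_0+BK)^T\\ A_0+BK & I\end{bmatrix}\succ0,$$ then $K$ is such that $\rho(M(K))<\alpha$, where $M(K)=(A_0+BK)\otimes(A_0+BK)+C_p$.
   Context: Notation: $\otimes$ is the Kronecker product; $\rho(\cdot)$ is the spectral radius of a square matrix; $\sigma_{max}(\cdot)$ is the maximal singular value; $I$ is the identity matrix of appropriate dimension (here $n\times n$); $\succ0$ means symmetric positive definite. *)

theory Defs
  imports "Jordan_Normal_Form.Spectral_Radius"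
begin

definition kronecker_prod :: "'a::times mat \<Rightarrow> 'a mat \<Rightarrow> 'a mat" where
  "kronecker_prod A B =
     mat (dim_row A * dim_row B) (dim_col A * dim_col B)
       (\<lambda>(i, j). A $$ (i div dim_row B, j div dim_col B) * B $$ (i mod dim_row B, j mod dim_col B))"

(* The Gram matrix is real symmetric, so all its eigenvalues are real and it is
   enough to take the spectrum over the reals. *)
definition singular_values :: "real mat \<Rightarrow> real set" where
  "singular_values A = sqrt ` spectrum (transpose_mat A * A)"

(* Max is meaningful only when A has at least one column. *)
definition max_singular_value :: "real mat \<Rightarrow> real" where
  "max_singular_value A = Max (singular_values A)"

(* The symmetry condition also forces A to be square. *)
definition sym_positive_definite :: "real mat \<Rightarrow> bool" where
  "sym_positive_definite A \<longleftrightarrow>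
     transpose_mat A = A \<and>
     (\<forall>v \<in> carrier_vec (dim_row A). v \<noteq> 0\<^sub>v (dim_row A) \<longrightarrow> v \<bullet> (A *\<^sub>v v) > 0)"

end

theory Submission
  imports Defs "HOL-Analysis.L2_Norm"
begin

text \<open>
  Write \<open>A = A0 + B K\<close> and \<open>s = max_singular_value Cp\<close>. Testing the block matrix on \<open>(x, -A x)\<close>
  gives \<open>|A x|\<^sup>2 < (\<alpha> - s) |x|\<^sup>2\<close>, so \<open>A \<otimes> A\<close> shrinks every nonzero vector
  strictly by more than the factor \<open>\<alpha> - s\<close>; with \<open>|Cp x| \<le> s |x|\<close> the triangle inequality yields
  \<open>|M x| < \<alpha> |x|\<close> for all real \<open>x \<noteq> 0\<close>. Splitting a complex eigenvector into real and imaginary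
  parts turns this into a bound on the spectral radius.

  That \<open>s\<close> bounds the operator norm is derived without the spectral theorem: for symmetric \<open>H\<close>
  the sequence \<open>|H^k x|\<^sup>2\<close> is log-convex, hence grows geometrically if \<open>|H x| > |x|\<close>, whereas the
  powers of \<open>H\<close> stay bounded if all eigenvalues have modulus below 1.
\<close>

section \<open>Euclidean norm of real vectors\<close>

lemma scalar_prod_self_eq_sum:
  "(x :: real vec) \<bullet> x = (\<Sum>i<dim_vec x. (x $ i)\<^sup>2)"
  by (simp add: scalar_prod_def power2_eq_square lessThan_atLeast0)

lemma scalar_prod_self_nonneg: "(x :: real vec) \<bullet> x \<ge> 0"
  by (simp add: scalar_prod_self_eq_sum sum_nonneg)

lemma scalar_prod_self_pos:
  assumes "(x :: real vec) \<in> carrier_vec n" "x \<noteq> 0\<^sub>v n"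
  shows "x \<bullet> x > 0"
proof -
  obtain i where "i < n" "x $ i \<noteq> 0"
    using assms by (metis carrier_vecD eq_vecI index_zero_vec)
  thus ?thesis
    using assms by (auto simp: scalar_prod_self_eq_sum intro!: sum_pos2[of _ i])
qed

text \<open>Carries the Cauchy-Schwarz and triangle inequalities over from
  \<open>L2_set\<close>.\<close>

lemma sqrt_scalar_prod_self: "sqrt ((x :: real vec) \<bullet> x) = L2_set (($) x) {..<dim_vec x}"
  by (simp add: L2_set_def scalar_prod_self_eq_sum)

lemma scalar_prod_Cauchy_Schwarz:
  assumes "(x :: real vec) \<in> carrier_vec n" "y \<in> carrier_vec n"
  shows "\<bar>x \<bullet> y\<bar> \<le> sqrt (x \<bullet> x) * sqrt (y \<bullet> y)"
proof -
  have "\<bar>x \<bullet> y\<bar> \<le> (\<Sum>i<n. \<bar>x $ i\<bar> * \<bar>y $ i\<bar>)"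
    using assms sum_abs[of "\<lambda>i. x $ i * y $ i" "{..<n}"]
    by (simp add: scalar_prod_def lessThan_atLeast0 abs_mult)
  also have "\<dots> \<le> sqrt (x \<bullet> x) * sqrt (y \<bullet> y)"
    using assms L2_set_mult_ineq[of "($) x" "($) y" "{..<n}"]
    by (simp add: sqrt_scalar_prod_self)
  finally show ?thesis .
qed

lemma sqrt_scalar_prod_triangle:
  assumes "(x :: real vec) \<in> carrier_vec n" "y \<in> carrier_vec n"
  shows "sqrt ((x + y) \<bullet> (x + y)) \<le> sqrt (x \<bullet> x) + sqrt (y \<bullet> y)"
proof -
  have "L2_set (($) (x + y)) {..<n} = L2_set (\<lambda>i. x $ i + y $ i) {..<n}"
    using assms by (intro L2_set_cong) auto
  thus ?thesis
    using assms L2_set_triangle_ineq[of "($) x" "($) y" "{..<n}"]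
    by (simp add: sqrt_scalar_prod_self)
qed

section \<open>Complex eigenvalues of real matrices and the spectral radius\<close>

text \<open>Take \<open>x\<close> and \<open>y\<close> to be the real and imaginary parts of an
  eigenvector and compare real and imaginary parts of the eigenvalue equation; \<open>M\<close> is
  real, so it acts on the two parts separately. Later arguments about the complex spectrum can then
  stay over the reals.\<close>

lemma complex_eigenvalue_real_parts:
  fixes M :: "real mat"
  assumes M: "M \<in> carrier_mat n n" and ev: "k \<in> spectrum (map_mat complex_of_real M)"
  obtains x y where "x \<in> carrier_vec n" "y \<in> carrier_vec n" "x \<noteq> 0\<^sub>v n \<or> y \<noteq> 0\<^sub>v n"
    "M *\<^sub>v x = Re k \<cdot>\<^sub>v x - Im k \<cdot>\<^sub>v y" "M *\<^sub>v y = Im k \<cdot>\<^sub>v x + Re k \<cdot>\<^sub>v y"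
proof -
  let ?M = "map_mat complex_of_real M"
  obtain v where v: "v \<in> carrier_vec n" "v \<noteq> 0\<^sub>v n" "?M *\<^sub>v v = k \<cdot>\<^sub>v v"
    using ev M by (auto simp: spectrum_def eigenvalue_def eigenvector_def)
  let ?x = "map_vec Re v" and ?y = "map_vec Im v"
  have nz: "?x \<noteq> 0\<^sub>v n \<or> ?y \<noteq> 0\<^sub>v n"
  proof (rule ccontr)
    assume "\<not> ?thesis"
    hence e: "?x = 0\<^sub>v n" "?y = 0\<^sub>v n" by auto
    have "v $ i = 0" if "i < n" for i
      using that v(1) arg_cong[OF e(1), of "\<lambda>u. u $ i"] arg_cong[OF e(2), of "\<lambda>u. u $ i"]
      by (simp add: complex_eq_iff)
    hence "v = 0\<^sub>v n" using v(1) by auto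
    with v(2) show False by simp
  qed
  have *: "(\<Sum>j<n. complex_of_real (M $$ (i, j)) * v $ j) = k * v $ i" if "i < n" for i
    using arg_cong[OF v(3), of "\<lambda>u. u $ i"] M v(1) that
    by (simp add: scalar_prod_def lessThan_atLeast0)
  have "(\<Sum>j<n. M $$ (i, j) * Re (v $ j)) = Re k * Re (v $ i) - Im k * Im (v $ i)"
    "(\<Sum>j<n. M $$ (i, j) * Im (v $ j)) = Im k * Re (v $ i) + Re k * Im (v $ i)" if "i < n" for i
    using arg_cong[OF *[OF that], of Re] arg_cong[OF *[OF that], of Im] by simp_all
  hence "M *\<^sub>v ?x = Re k \<cdot>\<^sub>v ?x - Im k \<cdot>\<^sub>v ?y" "M *\<^sub>v ?y = Im k \<cdot>\<^sub>v ?x + Re k \<cdot>\<^sub>v ?y"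
    using M v(1) by (auto intro!: eq_vecI simp: scalar_prod_def lessThan_atLeast0)
  with nz v(1) show ?thesis by (intro that[of ?x ?y]) auto
qed

text \<open>Adds the zero vector, where both sides vanish: one part of a complex eigenvector, or
  some blocks of a nonzero vector, may be zero.\<close>

lemma mat_vec_bound_of_strict:
  fixes M :: "real mat"
  assumes M: "M \<in> carrier_mat m n"
    and less: "\<And>x. x \<in> carrier_vec n \<Longrightarrow> x \<noteq> 0\<^sub>v n \<Longrightarrow>
      (M *\<^sub>v x) \<bullet> (M *\<^sub>v x) < c * (x \<bullet> x)"
    and x: "x \<in> carrier_vec n"
  shows "(M *\<^sub>v x) \<bullet> (M *\<^sub>v x) \<le> c * (x \<bullet> x)"
proof (cases "x = 0\<^sub>v n")
  case True
  moreover have "M *\<^sub>v 0\<^sub>v n = 0\<^sub>v m" using M by (intro eq_vecI) auto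
  ultimately show ?thesis by simp
qed (use less[OF x] in simp)

text \<open>For an eigenvector x + iy to an eigenvalue \<open>k\<close> of maximal modulus, |Mx|^2 +
  |My|^2 equals |k|^2 (|x|^2 + |y|^2), while the real bound applies to x and y separately.\<close>

lemma spectral_radius_less_if_contracting:
  fixes M :: "real mat"
  assumes M: "M \<in> carrier_mat n n" and n: "n > 0" and a: "a > 0"
    and less: "\<And>x. x \<in> carrier_vec n \<Longrightarrow> x \<noteq> 0\<^sub>v n \<Longrightarrow>
      (M *\<^sub>v x) \<bullet> (M *\<^sub>v x) < a\<^sup>2 * (x \<bullet> x)"
  shows "spectral_radius (map_mat complex_of_real M) < a"
proof -
  let ?M = "map_mat complex_of_real M"
  have cM: "?M \<in> carrier_mat n n" using M by auto
  obtain k where k: "k \<in> spectrum ?M" "spectral_radius ?M = cmod k"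
    using spectral_radius_mem_max(1)[OF cM n] by auto
  obtain x y where xy: "x \<in> carrier_vec n" "y \<in> carrier_vec n" "x \<noteq> 0\<^sub>v n \<or> y \<noteq> 0\<^sub>v n"
    "M *\<^sub>v x = Re k \<cdot>\<^sub>v x - Im k \<cdot>\<^sub>v y" "M *\<^sub>v y = Im k \<cdot>\<^sub>v x + Re k \<cdot>\<^sub>v y"
    using complex_eigenvalue_real_parts[OF M k(1)] by blast
  let ?q = "x \<bullet> x + y \<bullet> y"
  have le: "(M *\<^sub>v z) \<bullet> (M *\<^sub>v z) \<le> a\<^sup>2 * (z \<bullet> z)" if "z \<in> carrier_vec n" for z
    using mat_vec_bound_of_strict[OF M less that] .
  \<comment> \<open>At least one of \<open>x\<close>, \<open>y\<close> is nonzero and gives the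
    strict inequality; the other may only give \<open>le\<close>.\<close>
  have "(M *\<^sub>v x) \<bullet> (M *\<^sub>v x) + (M *\<^sub>v y) \<bullet> (M *\<^sub>v y) < a\<^sup>2 * ?q"
    using le[OF xy(1)] le[OF xy(2)] less[OF xy(1)] less[OF xy(2)] xy(3)
    unfolding distrib_left by linarith
  moreover have "(M *\<^sub>v x) \<bullet> (M *\<^sub>v x) + (M *\<^sub>v y) \<bullet> (M *\<^sub>v y) = (cmod k)\<^sup>2 * ?q"
  proof -
    have "(M *\<^sub>v x) \<bullet> (M *\<^sub>v x) + (M *\<^sub>v y) \<bullet> (M *\<^sub>v y) =
        (\<Sum>i<n. (Re k * x $ i - Im k * y $ i)\<^sup>2 + (Im k * x $ i + Re k * y $ i)\<^sup>2)"
      unfolding xy(4,5) using xy(1,2) by (simp add: scalar_prod_self_eq_sum sum.distrib)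
    \<comment> \<open>The mixed terms in \<open>x $ i * y $ i\<close> cancel between the two
      squares.\<close>
    also have "\<dots> = (\<Sum>i<n. (cmod k)\<^sup>2 * ((x $ i)\<^sup>2 + (y $ i)\<^sup>2))"
      unfolding cmod_power2 by (intro sum.cong refl) (simp add: power2_eq_square algebra_simps)
    also have "\<dots> = (cmod k)\<^sup>2 * ?q"
      using xy(1,2) by (simp add: scalar_prod_self_eq_sum sum.distrib flip: sum_distrib_left)
    finally show ?thesis .
  qed
  moreover have "?q > 0"
    using xy scalar_prod_self_pos[of x n] scalar_prod_self_pos[of y n]
      scalar_prod_self_nonneg[of x] scalar_prod_self_nonneg[of y]
    by linarith
  ultimately have "(cmod k)\<^sup>2 < a\<^sup>2" by simp
  thus ?thesis using k(2) a by (simp add: power2_less_imp_less)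
qed

section \<open>Symmetric matrices: real spectrum and the norm bound by eigenvalues\<close>

lemma symmetric_scalar_prod:
  assumes "(H :: real mat) \<in> carrier_mat n n" "transpose_mat H = H"
    "x \<in> carrier_vec n" "y \<in> carrier_vec n"
  shows "x \<bullet> (H *\<^sub>v y) = (H *\<^sub>v x) \<bullet> y"
  using transpose_vec_mult_scalar[OF assms(1,4,3)] assms(2) by simp

lemma symmetric_complex_eigenvalue:
  fixes H :: "real mat"
  assumes H: "H \<in> carrier_mat n n" "transpose_mat H = H"
    and k: "k \<in> spectrum (map_mat complex_of_real H)"
  shows "Im k = 0" "Re k \<in> spectrum H"
proof -
  obtain x y where xy: "x \<in> carrier_vec n" "y \<in> carrier_vec n" "x \<noteq> 0\<^sub>v n \<or> y \<noteq> 0\<^sub>v n"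
    "H *\<^sub>v x = Re k \<cdot>\<^sub>v x - Im k \<cdot>\<^sub>v y" "H *\<^sub>v y = Im k \<cdot>\<^sub>v x + Re k \<cdot>\<^sub>v y"
    using complex_eigenvalue_real_parts[OF H(1) k] by blast
  have "x \<bullet> (H *\<^sub>v y) = (H *\<^sub>v x) \<bullet> y"
    by (rule symmetric_scalar_prod[OF H xy(1,2)])
  \<comment> \<open>The terms with \<open>Re k\<close> are the same on both sides and drop
    out.\<close>
  hence "Im k * (x \<bullet> x + y \<bullet> y) = 0"
    unfolding xy(4,5) using xy(1,2)
    by (simp add: scalar_prod_add_distrib[of _ n] minus_scalar_prod_distrib[of _ n]
        algebra_simps)
  moreover have "x \<bullet> x + y \<bullet> y > 0"
    using xy scalar_prod_self_pos[of x n] scalar_prod_self_pos[of y n]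
      scalar_prod_self_nonneg[of x] scalar_prod_self_nonneg[of y]
    by linarith
  ultimately show Im: "Im k = 0" by simp
  \<comment> \<open>With \<open>Im k = 0\<close> the system decouples, so whichever of
    \<open>x\<close>, \<open>y\<close> is nonzero is a real eigenvector.\<close>
  have "H *\<^sub>v x = Re k \<cdot>\<^sub>v x" "H *\<^sub>v y = Re k \<cdot>\<^sub>v y"
    unfolding xy(4,5) Im using xy(1,2) by auto
  with xy H show "Re k \<in> spectrum H"
    by (auto simp: spectrum_def eigenvalue_def eigenvector_def)
qed

text \<open>Log-convexity makes the ratios of consecutive terms nondecreasing; the first ratio
  \<open>t\<close> exceeds 1, so \<open>q\<close> dominates a growing geometric sequence.\<close>

lemma log_convex_unbounded:
  fixes q :: "nat \<Rightarrow> real"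
  assumes nonneg: "\<And>k. q k \<ge> 0" and conv: "\<And>k. (q (Suc k))\<^sup>2 \<le> q k * q (Suc (Suc k))"
    and gt: "q 1 > q 0"
  shows "\<exists>k. q k > b"
proof -
  \<comment> \<open>If \<open>q 0\<close> were 0, \<open>conv\<close> at 0 would force
    \<open>q 1 = 0\<close>, against \<open>gt\<close>.\<close>
  have q0: "q 0 > 0"
    using nonneg[of 0] conv[of 0] gt by (cases "q 0 = 0") auto
  define t where "t = q 1 / q 0"
  have t: "t > 1" using gt q0 by (simp add: t_def)
  have step: "q k > 0 \<and> q (Suc k) \<ge> t * q k" for k
  proof (induction k)
    case 0
    show ?case using q0 by (simp add: t_def)
  next
    case (Suc k)
    have pos: "q (Suc k) > 0" 
    proof -
      have "0 < t * q k" using Suc t by simp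
      with Suc show ?thesis by linarith
    qed
    \<comment> \<open>The induction hypothesis times \<open>q (Suc k)\<close>; after
      \<open>conv\<close> the positive factor \<open>q k\<close> is cancelled.\<close>
    have "q k * (t * q (Suc k)) \<le> q (Suc k) * q (Suc k)"
      using Suc pos by (simp add: mult.commute mult.left_commute mult_left_mono)
    also have "\<dots> \<le> q k * q (Suc (Suc k))"
      using conv[of k] by (simp add: power2_eq_square)
    finally show ?case using pos Suc by simp
  qed
  have pow: "q k \<ge> t ^ k * q 0" for k
  proof (induction k)
    case (Suc k)
    have "t ^ Suc k * q 0 \<le> t * q k" using Suc t by simp
    with step[of k] show ?case by linarith
  qed simp
  obtain k where "b / q 0 < t ^ k" using real_arch_pow[OF t] by blast
  hence "b < t ^ k * q 0" using q0 by (simp add: field_simps)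
  with pow[of k] show ?thesis by (intro exI[of _ k]) linarith
qed

lemma symmetric_contraction:
  fixes H :: "real mat"
  assumes H: "H \<in> carrier_mat n n" "transpose_mat H = H" and n: "n > 0"
    and ev: "\<And>e. e \<in> spectrum H \<Longrightarrow> \<bar>e\<bar> < 1"
    and x: "x \<in> carrier_vec n"
  shows "(H *\<^sub>v x) \<bullet> (H *\<^sub>v x) \<le> x \<bullet> x"
proof (rule ccontr)
  assume neg: "\<not> ?thesis"
  let ?H = "map_mat complex_of_real H"
  have cH: "?H \<in> carrier_mat n n" using H by auto
  obtain k where k: "k \<in> spectrum ?H" "spectral_radius ?H = cmod k"
    using spectral_radius_mem_max(1)[OF cH n] by auto
  have "spectral_radius ?H < 1"
    using symmetric_complex_eigenvalue[OF H k(1)] ev k(2) by (simp add: cmod_eq_Re)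
  \<comment> \<open>Spectral radius below 1 yields one constant bounding every entry of every
    power.\<close>
  then obtain c where c: "\<And>k. norm_bound (?H ^\<^sub>m k) c"
    using spectral_radius_jnf_norm_bound_less_1_upper_triangular[OF cH] by blast
  define u where "u k = (H ^\<^sub>m k) *\<^sub>v x" for k
  have pc: "H ^\<^sub>m k \<in> carrier_mat n n" for k using H by simp
  have u: "u k \<in> carrier_vec n" for k using pc[of k] x by (simp add: u_def)
  have u_Suc: "u (Suc k) = H *\<^sub>v u k" for k
  proof -
    \<comment> \<open>Matrix powers grow by a factor on the right; the recursion for
      \<open>u\<close> needs it on the left.\<close>
    have "H ^\<^sub>m Suc k = H * H ^\<^sub>m k"
      by (induction k) (use H in \<open>auto simp: assoc_mult_mat[OF H(1) _ H(1)]\<close>)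
    thus ?thesis by (simp only: u_def assoc_mult_mat_vec[OF H(1) pc x])
  qed
  define q where "q k = u k \<bullet> u k" for k
  have conv: "(q (Suc k))\<^sup>2 \<le> q k * q (Suc (Suc k))" for k
  proof -
    \<comment> \<open>Symmetry moves one factor \<open>H\<close> to the other side; Cauchy-Schwarz
      then gives log-convexity.\<close>
    have "q (Suc k) = u k \<bullet> u (Suc (Suc k))"
      unfolding q_def using symmetric_scalar_prod[OF H u[of k] u[of "Suc k"]]
      by (simp add: u_Suc)
    hence "\<bar>q (Suc k)\<bar> \<le> sqrt (q k) * sqrt (q (Suc (Suc k)))"
      using scalar_prod_Cauchy_Schwarz[OF u u] by (simp add: q_def)
    hence "\<bar>q (Suc k)\<bar>\<^sup>2 \<le> (sqrt (q k) * sqrt (q (Suc (Suc k))))\<^sup>2"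
      by (intro power_mono) auto
    thus ?thesis by (simp add: power_mult_distrib q_def scalar_prod_self_nonneg)
  qed
  have "q 1 > q 0"
    using neg x H unfolding q_def by (simp add: u_def)
  \<comment> \<open>The threshold bounds |H^k x|^2 for every k once all entries of the powers are at
    most \<open>c\<close> in modulus; it does not depend on k.\<close>
  then obtain k where k: "q k > (\<Sum>i<n. (\<Sum>j<n. c * \<bar>x $ j\<bar>)\<^sup>2)"
    using log_convex_unbounded[of q] conv by (auto simp: q_def scalar_prod_self_nonneg)
  have entry: "\<bar>(H ^\<^sub>m k) $$ (i, j)\<bar> \<le> c" if "i < n" "j < n" for i j
  proof -
    have "cmod ((?H ^\<^sub>m k) $$ (i, j)) \<le> c"
      using c[of k] that cH by (auto simp: norm_bound_def)
    also have "?H ^\<^sub>m k = map_mat complex_of_real (H ^\<^sub>m k)"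
      by (rule of_real_hom.mat_hom_pow[OF H(1), symmetric])
    finally show ?thesis using that carrier_matD[OF pc[of k]] H(1) by simp
  qed
  have "\<bar>u k $ i\<bar> \<le> (\<Sum>j<n. c * \<bar>x $ j\<bar>)" if "i < n" for i
  proof -
    have "u k $ i = (\<Sum>j<n. (H ^\<^sub>m k) $$ (i, j) * x $ j)"
      using that pc[of k] x H(1) by (simp add: u_def scalar_prod_def lessThan_atLeast0)
    also have "\<bar>\<dots>\<bar> \<le> (\<Sum>j<n. \<bar>(H ^\<^sub>m k) $$ (i, j) * x $ j\<bar>)" by (rule sum_abs)
    also have "\<dots> \<le> (\<Sum>j<n. c * \<bar>x $ j\<bar>)"
      using entry that by (intro sum_mono) (auto simp: abs_mult intro: mult_right_mono)
    finally show ?thesis .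
  qed
  hence "(u k $ i)\<^sup>2 \<le> (\<Sum>j<n. c * \<bar>x $ j\<bar>)\<^sup>2" if "i < n" for i
    using that by (metis abs_ge_zero power2_abs power_mono)
  hence "q k \<le> (\<Sum>i<n. (\<Sum>j<n. c * \<bar>x $ j\<bar>)\<^sup>2)"
    unfolding q_def scalar_prod_self_eq_sum carrier_vecD[OF u] by (intro sum_mono) blast
  with k show False by linarith
qed

text \<open>For every r > a the matrix G/r has all eigenvalues of modulus below 1 and is therefore a
  contraction; then r tends to a. Going through r > a supplies the strict eigenvalue bound and
  avoids dividing by a = 0.\<close>

lemma symmetric_bound:
  fixes G :: "real mat"
  assumes G: "G \<in> carrier_mat n n" "transpose_mat G = G" and n: "n > 0"
    and ev: "\<And>e. e \<in> spectrum G \<Longrightarrow> \<bar>e\<bar> \<le> a"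
    and a: "a \<ge> 0" and x: "x \<in> carrier_vec n"
  shows "sqrt ((G *\<^sub>v x) \<bullet> (G *\<^sub>v x)) \<le> a * sqrt (x \<bullet> x)"
proof -
  have bound: "sqrt ((G *\<^sub>v x) \<bullet> (G *\<^sub>v x)) \<le> r * sqrt (x \<bullet> x)" if r: "r > a" for r
  proof -
    have r0: "r > 0" using r a by simp
    define H where "H = (1 / r) \<cdot>\<^sub>m G"
    have Hv: "H *\<^sub>v v = (1 / r) \<cdot>\<^sub>v (G *\<^sub>v v)" if "v \<in> carrier_vec n" for v
      using that G(1) unfolding H_def by auto
    have "transpose_mat H = (1 / r) \<cdot>\<^sub>m transpose_mat G"
      unfolding H_def by (intro eq_matI) auto
    hence H: "H \<in> carrier_mat n n" "transpose_mat H = H"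
      using G by (simp_all add: H_def)
    have "\<bar>e\<bar> < 1" if e: "e \<in> spectrum H" for e
    proof -
      obtain v where v: "v \<in> carrier_vec n" "v \<noteq> 0\<^sub>v n" "H *\<^sub>v v = e \<cdot>\<^sub>v v"
        using e H(1) by (auto simp: spectrum_def eigenvalue_def eigenvector_def)
      have "G *\<^sub>v v = r \<cdot>\<^sub>v (H *\<^sub>v v)"
        using r0 by (simp add: Hv[OF v(1)] smult_smult_assoc)
      hence "G *\<^sub>v v = (r * e) \<cdot>\<^sub>v v" by (simp add: v(3) smult_smult_assoc)
      with v G have "r * e \<in> spectrum G"
        by (auto simp: spectrum_def eigenvalue_def eigenvector_def)
      from ev[OF this] have "r * \<bar>e\<bar> \<le> a" using r0 by (simp add: abs_mult)
      hence "r * \<bar>e\<bar> < r * 1" using r by linarith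
      thus ?thesis using r0 by (simp only: mult_less_cancel_left_pos)
    qed
    from symmetric_contraction[OF H n this x]
    have "((1 / r) \<cdot>\<^sub>v (G *\<^sub>v x)) \<bullet> ((1 / r) \<cdot>\<^sub>v (G *\<^sub>v x)) \<le> x \<bullet> x"
      by (simp add: Hv[OF x])
    hence "(G *\<^sub>v x) \<bullet> (G *\<^sub>v x) \<le> r\<^sup>2 * (x \<bullet> x)"
      using r0 by (simp add: field_simps power2_eq_square)
    hence "sqrt ((G *\<^sub>v x) \<bullet> (G *\<^sub>v x)) \<le> sqrt (r\<^sup>2 * (x \<bullet> x))"
      by (rule real_sqrt_le_mono)
    thus ?thesis using r0 by (simp add: real_sqrt_mult)
  qed
  show ?thesis
  proof (cases "x \<bullet> x = 0")
    case True
    \<comment> \<open>Any r > a would do, as the right-hand side is 0.\<close>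
    with bound[of "a + 1"] show ?thesis by simp
  next
    case False
    hence s: "sqrt (x \<bullet> x) > 0" using scalar_prod_self_nonneg[of x] by simp
    have "sqrt ((G *\<^sub>v x) \<bullet> (G *\<^sub>v x)) / sqrt (x \<bullet> x) \<le> a"
      \<comment> \<open>The limit r to a: the quotient is at most every r > a.\<close>
      by (rule dense_ge) (use bound s in \<open>auto simp: field_simps\<close>)
    thus ?thesis using s by (simp add: field_simps)
  qed
qed

section \<open>The maximal singular value bounds the operator norm\<close>

text \<open>The eigenvalues of the Gram matrix G lie between 0 and s^2, so |Gx| \<le> s^2 |x|, and
  |Cx|^2 = x.Gx \<le> |x| |Gx| by Cauchy-Schwarz.\<close>

lemma max_singular_value_bound:
  fixes C :: "real mat"
  assumes C: "C \<in> carrier_mat m n" and n: "n > 0"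
  shows "max_singular_value C \<ge> 0"
    and "x \<in> carrier_vec n \<Longrightarrow>
      sqrt ((C *\<^sub>v x) \<bullet> (C *\<^sub>v x)) \<le> max_singular_value C * sqrt (x \<bullet> x)"
proof -
  define G where "G = transpose_mat C * C"
  let ?s = "max_singular_value C"
  have G: "G \<in> carrier_mat n n" "transpose_mat G = G"
    using C by (auto simp: G_def transpose_mult[of _ n m _ n])
  have quad: "v \<bullet> (G *\<^sub>v v) = (C *\<^sub>v v) \<bullet> (C *\<^sub>v v)" if v: "v \<in> carrier_vec n" for v
  proof -
    have Cv: "C *\<^sub>v v \<in> carrier_vec m" using C v by simp
    have "G *\<^sub>v v = transpose_mat C *\<^sub>v (C *\<^sub>v v)"
      using C v by (simp add: G_def)
    with transpose_vec_mult_scalar[OF C v Cv] show ?thesis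
      using C v Cv by (simp add: comm_scalar_prod[of v n])
  qed
  have fin: "finite (singular_values C)"
    using card_finite_spectrum(1)[OF G(1)] by (simp add: singular_values_def G_def)
  have ev: "e \<ge> 0 \<and> sqrt e \<le> ?s" if e: "e \<in> spectrum G" for e
  proof -
    obtain v where v: "v \<in> carrier_vec n" "v \<noteq> 0\<^sub>v n" "G *\<^sub>v v = e \<cdot>\<^sub>v v"
      using e G by (auto simp: spectrum_def eigenvalue_def eigenvector_def)
    have "e * (v \<bullet> v) \<ge> 0"
      using quad[OF v(1)] v by (simp add: scalar_prod_self_nonneg)
    hence "e \<ge> 0" using scalar_prod_self_pos[OF v(1,2)] by (simp add: zero_le_mult_iff)
    moreover have "sqrt e \<in> singular_values C"
      using e by (simp add: singular_values_def G_def)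
    ultimately show ?thesis using fin by (simp add: max_singular_value_def)
  qed
  \<comment> \<open>The complex spectrum is nonempty for n > 0 and, by symmetry, real. So
    \<open>Max\<close> ranges over a nonempty set and dominates a nonnegative element.\<close>
  have "map_mat complex_of_real G \<in> carrier_mat n n" using G by simp
  then obtain k where "k \<in> spectrum (map_mat complex_of_real G)"
    using spectrum_non_empty n by blast
  hence "Re k \<in> spectrum G" by (rule symmetric_complex_eigenvalue(2)[OF G])
  from ev[OF this] show s0: "?s \<ge> 0" using order_trans real_sqrt_ge_zero by blast
  assume x: "x \<in> carrier_vec n"
  have "\<bar>e\<bar> \<le> ?s\<^sup>2" if "e \<in> spectrum G" for e
    using ev[OF that] power_mono[of "sqrt e" ?s 2] by simp
  from symmetric_bound[OF G n this _ x]
  have "sqrt ((G *\<^sub>v x) \<bullet> (G *\<^sub>v x)) \<le> ?s\<^sup>2 * sqrt (x \<bullet> x)" by simp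
  hence "sqrt (x \<bullet> x) * sqrt ((G *\<^sub>v x) \<bullet> (G *\<^sub>v x)) \<le> sqrt (x \<bullet> x) * (?s\<^sup>2 * sqrt (x \<bullet> x))"
    by (intro mult_left_mono) (auto simp: scalar_prod_self_nonneg)
  moreover have "(C *\<^sub>v x) \<bullet> (C *\<^sub>v x) \<le> sqrt (x \<bullet> x) * sqrt ((G *\<^sub>v x) \<bullet> (G *\<^sub>v x))"
    using scalar_prod_Cauchy_Schwarz[OF x, of "G *\<^sub>v x"] quad[OF x] G(1) x by simp
  ultimately have "(C *\<^sub>v x) \<bullet> (C *\<^sub>v x) \<le> (?s * sqrt (x \<bullet> x))\<^sup>2"
    by (simp add: power2_eq_square mult_ac)
  thus "sqrt ((C *\<^sub>v x) \<bullet> (C *\<^sub>v x)) \<le> ?s * sqrt (x \<bullet> x)"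
    using s0 by (intro real_le_lsqrt) (auto simp: scalar_prod_self_nonneg)
qed

section \<open>Norm bound for Kronecker products\<close>

text \<open>Splits an index as in \<open>kronecker_prod\<close>: \<open>i\<close> is the quotient
  and \<open>j\<close> the remainder modulo \<open>m\<close>.\<close>

lemma sum_lessThan_mult:
  fixes f :: "nat \<Rightarrow> 'a::comm_monoid_add"
  shows "(\<Sum>k<n * m. f k) = (\<Sum>i<n. \<Sum>j<m. f (i * m + j))"
proof -
  have "sum f {i * m..<i * m + m} = (\<Sum>j<m. f (i * m + j))" for i
    using sum.shift_bounds_nat_ivl[of f 0 "i * m" m]
    by (simp add: add.commute lessThan_atLeast0)
  thus ?thesis using sum.nat_group[of f m n] by simp
qed

lemma kronecker_index_less:
  fixes i j m n :: nat
  assumes "i < n" "j < m"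
  shows "i * m + j < n * m"
proof -
  have "i * m + j < Suc i * m" using assms(2) by simp
  also have "\<dots> \<le> n * m" using assms(1) by (intro mult_le_mono1) simp
  finally show ?thesis .
qed

lemma kronecker_prod_contracting:
  fixes A B :: "real mat"
  assumes A: "A \<in> carrier_mat n n'" and B: "B \<in> carrier_mat m m'" and a: "a > 0"
    and leA: "\<And>x. x \<in> carrier_vec n' \<Longrightarrow> (A *\<^sub>v x) \<bullet> (A *\<^sub>v x) \<le> a * (x \<bullet> x)"
    and lessB: "\<And>x. x \<in> carrier_vec m' \<Longrightarrow> x \<noteq> 0\<^sub>v m' \<Longrightarrow>
      (B *\<^sub>v x) \<bullet> (B *\<^sub>v x) < b * (x \<bullet> x)"
    and x: "x \<in> carrier_vec (n' * m')" "x \<noteq> 0\<^sub>v (n' * m')"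
  shows "(kronecker_prod A B *\<^sub>v x) \<bullet> (kronecker_prod A B *\<^sub>v x) < a * b * (x \<bullet> x)"
proof -
  \<comment> \<open>In the block view of \<open>x\<close>, \<open>A \<otimes> B\<close> applies \<open>B\<close> within each block \<open>X i\<close> and then \<open>A\<close> across the blocks.\<close>
  define X where "X i = vec m' (\<lambda>j. x $ (i * m' + j))" for i
  define W where "W j = vec n' (\<lambda>i. (B *\<^sub>v X i) $ j)" for j
  have X: "X i \<in> carrier_vec m'" for i by (simp add: X_def)
  have W: "W j \<in> carrier_vec n'" for j by (simp add: W_def)
  have entry: "(kronecker_prod A B *\<^sub>v x) $ (i * m + j) = (A *\<^sub>v W j) $ i"
    if "i < n" "j < m" for i j
  proof -
    have "(kronecker_prod A B *\<^sub>v x) $ (i * m + j) =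
        (\<Sum>k<n' * m'. A $$ (i, k div m') * B $$ (j, k mod m') * x $ k)"
      using that kronecker_index_less[OF that] A B x(1)
      by (simp add: kronecker_prod_def scalar_prod_def lessThan_atLeast0)
    also have "\<dots> = (\<Sum>k<n'. \<Sum>l<m'. A $$ (i, k) * (B $$ (j, l) * x $ (k * m' + l)))"
      unfolding sum_lessThan_mult by (intro sum.cong) auto
    also have "\<dots> = (A *\<^sub>v W j) $ i"
      using that A B
      by (simp add: W_def X_def scalar_prod_def lessThan_atLeast0 sum_distrib_left)
    finally show ?thesis .
  qed
  have xX: "x \<bullet> x = (\<Sum>i<n'. X i \<bullet> X i)"
    using x(1) by (simp add: scalar_prod_self_eq_sum sum_lessThan_mult X_def)
  have "\<exists>i<n'. X i \<noteq> 0\<^sub>v m'"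
  proof (rule ccontr)
    assume "\<not> ?thesis"
    hence "x \<bullet> x = 0" by (simp add: xX)
    with scalar_prod_self_pos[OF x] show False by simp
  qed
  \<comment> \<open>This block is the source of strictness; the remaining blocks only need
    \<open>leB\<close>.\<close>
  then obtain i0 where i0: "i0 < n'" "X i0 \<noteq> 0\<^sub>v m'" by blast
  have leB: "(B *\<^sub>v z) \<bullet> (B *\<^sub>v z) \<le> b * (z \<bullet> z)" if "z \<in> carrier_vec m'" for z
    using mat_vec_bound_of_strict[OF B lessB that] .
  have "(kronecker_prod A B *\<^sub>v x) \<bullet> (kronecker_prod A B *\<^sub>v x) =
      (\<Sum>i<n. \<Sum>j<m. ((A *\<^sub>v W j) $ i)\<^sup>2)"
  proof -
    have "dim_vec (kronecker_prod A B *\<^sub>v x) = n * m"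
      using A B by (simp add: kronecker_prod_def)
    thus ?thesis
      by (simp add: scalar_prod_self_eq_sum sum_lessThan_mult entry del: index_mult_mat_vec)
  qed
  also have "\<dots> = (\<Sum>j<m. (A *\<^sub>v W j) \<bullet> (A *\<^sub>v W j))"
    using A by (subst sum.swap) (simp add: scalar_prod_self_eq_sum)
  also have "\<dots> \<le> (\<Sum>j<m. a * (W j \<bullet> W j))"
    by (intro sum_mono leA W)
  \<comment> \<open>\<open>W j\<close> collects the \<open>j\<close>-th entries of all
    \<open>B *\<^sub>v X i\<close>, so exchanging the sums regroups them by blocks.\<close>
  also have "\<dots> = a * (\<Sum>j<m. \<Sum>i<n'. ((B *\<^sub>v X i) $ j)\<^sup>2)"
    by (simp add: scalar_prod_self_eq_sum W_def sum_distrib_left)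
  also have "\<dots> = a * (\<Sum>i<n'. (B *\<^sub>v X i) \<bullet> (B *\<^sub>v X i))"
    using B by (subst sum.swap) (simp add: scalar_prod_self_eq_sum)
  also have "\<dots> < a * (\<Sum>i<n'. b * (X i \<bullet> X i))"
    by (intro mult_strict_left_mono[OF _ a] sum_strict_mono_ex1)
      (use leB[OF X] lessB[OF X] i0 in auto)
  also have "\<dots> = a * b * (x \<bullet> x)"
    by (simp add: xX sum_distrib_left mult.assoc)
  finally show ?thesis .
qed

section \<open>Contraction from the block matrix inequality\<close>

text \<open>For fixed x the quadratic form c|x|^2 + 2 y.Ax + |y|^2 is minimal at y = -Ax, with value
  c|x|^2 - |Ax|^2; positivity there is the claim.\<close>

lemma schur_complement_contracting:
  fixes A :: "real mat"
  assumes A: "A \<in> carrier_mat n n"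
    and pd: "sym_positive_definite
      (four_block_mat (c \<cdot>\<^sub>m 1\<^sub>m n) (transpose_mat A) A (1\<^sub>m n))"
    and x: "x \<in> carrier_vec n" "x \<noteq> 0\<^sub>v n"
  shows "(A *\<^sub>v x) \<bullet> (A *\<^sub>v x) < c * (x \<bullet> x)"
proof -
  let ?S = "four_block_mat (c \<cdot>\<^sub>m 1\<^sub>m n) (transpose_mat A) A (1\<^sub>m n)"
  let ?y = "A *\<^sub>v x"
  have y: "?y \<in> carrier_vec n" using A x by simp
  let ?v = "x @\<^sub>v (- ?y)"
  have v: "?v \<in> carrier_vec (n + n)" using x y by auto
  have "?v \<noteq> 0\<^sub>v (n + n)"
  proof
    assume z: "?v = 0\<^sub>v (n + n)"
    have "x $ i = 0" if "i < n" for i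
      using arg_cong[OF z, of "\<lambda>u. u $ i"] that x(1) y by simp
    hence "x = 0\<^sub>v n" using x(1) by auto
    with x(2) show False by simp
  qed
  with pd v A have "?v \<bullet> (?S *\<^sub>v ?v) > 0" by (simp add: sym_positive_definite_def)
  also have "?S *\<^sub>v ?v = (c \<cdot>\<^sub>v x + transpose_mat A *\<^sub>v (- ?y)) @\<^sub>v (?y + - ?y)"
    using A x y by (subst four_block_mat_mult_vec[of _ n n _ n _ n]) auto
  \<comment> \<open>The lower block \<open>?y + - ?y\<close> is zero, so only the upper one
    contributes.\<close>
  also have "?v \<bullet> \<dots> = c * (x \<bullet> x) + x \<bullet> (transpose_mat A *\<^sub>v (- ?y))"
    using A x y
    by (subst scalar_prod_append[of _ n _ n]) (auto simp: scalar_prod_add_distrib[of _ n])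
  also have "x \<bullet> (transpose_mat A *\<^sub>v (- ?y)) = - (?y \<bullet> ?y)"
    using transpose_vec_mult_scalar[OF A x(1), of "- ?y"] A x y
    by (simp add: comm_scalar_prod[of x n])
  finally show ?thesis by simp
qed

section \<open>Combination of the bounds for the Kronecker square and \<open>Cp\<close>\<close>

theorem theorem1:
  fixes n m :: nat and A0 B Cp K :: "real mat" and \<alpha> :: real
  assumes "n > 0"
    and "A0 \<in> carrier_mat n n"
    and "B \<in> carrier_mat n m"
    and "Cp \<in> carrier_mat (n\<^sup>2) (n\<^sup>2)"
    and "K \<in> carrier_mat m n"
    and "0 < \<alpha>" and "\<alpha> < 1"
    and "sym_positive_definite
           (four_block_mat
              ((\<alpha> - max_singular_value Cp) \<cdot>\<^sub>m 1\<^sub>m n) (transpose_mat (A0 + B * K))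
              (A0 + B * K)                           (1\<^sub>m n))"
  shows "spectral_radius
           (map_mat complex_of_real (kronecker_prod (A0 + B * K) (A0 + B * K) + Cp)) < \<alpha>"
proof -
  define A where "A = A0 + B * K"
  define s where "s = max_singular_value Cp"
  have A: "A \<in> carrier_mat n n" using assms by (simp add: A_def)
  have N: "n * n > 0" using assms(1) by simp
  have C: "Cp \<in> carrier_mat (n * n) (n * n)" using assms(4) by (simp add: power2_eq_square)
  have less: "(A *\<^sub>v x) \<bullet> (A *\<^sub>v x) < (\<alpha> - s) * (x \<bullet> x)"
    if "x \<in> carrier_vec n" "x \<noteq> 0\<^sub>v n" for x
    by (rule schur_complement_contracting[OF A _ that])
      (use assms(8) in \<open>simp add: A_def s_def\<close>)
  have le: "(A *\<^sub>v x) \<bullet> (A *\<^sub>v x) \<le> (\<alpha> - s) * (x \<bullet> x)" if "x \<in> carrier_vec n" for x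
    using mat_vec_bound_of_strict[OF A less that] .
  \<comment> \<open>Follows by testing \<open>less\<close> on a unit vector; it makes \<alpha> - s
    an admissible factor for the Kronecker bound and lets it come out of the square root.\<close>
  have pos: "\<alpha> - s > 0"
  proof -
    let ?e = "unit_vec n 0 :: real vec"
    have "?e \<noteq> 0\<^sub>v n" using assms(1) by simp
    hence "0 < (\<alpha> - s) * (?e \<bullet> ?e)"
      using less[of ?e] scalar_prod_self_nonneg[of "A *\<^sub>v ?e"] by simp
    thus ?thesis using assms(1) by simp
  qed
  let ?T = "kronecker_prod A A"
  have T: "?T \<in> carrier_mat (n * n) (n * n)" using A by (simp add: kronecker_prod_def)
  have "((?T + Cp) *\<^sub>v x) \<bullet> ((?T + Cp) *\<^sub>v x) < \<alpha>\<^sup>2 * (x \<bullet> x)"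
    if x: "x \<in> carrier_vec (n * n)" "x \<noteq> 0\<^sub>v (n * n)" for x
  proof -
    have eq: "(?T + Cp) *\<^sub>v x = ?T *\<^sub>v x + Cp *\<^sub>v x"
      using T C x by (simp add: add_mult_distrib_mat_vec)
    \<comment> \<open>Each of the two factors \<open>A\<close> contributes \<alpha> - s to the
      squared norm, hence \<alpha> - s in total to the norm.\<close>
    have "(?T *\<^sub>v x) \<bullet> (?T *\<^sub>v x) < (\<alpha> - s)\<^sup>2 * (x \<bullet> x)"
      using kronecker_prod_contracting[OF A A pos le less x] by (simp add: power2_eq_square)
    hence "sqrt ((?T *\<^sub>v x) \<bullet> (?T *\<^sub>v x)) < (\<alpha> - s) * sqrt (x \<bullet> x)"
      using pos real_sqrt_less_mono by (fastforce simp: real_sqrt_mult)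
    moreover have "sqrt ((Cp *\<^sub>v x) \<bullet> (Cp *\<^sub>v x)) \<le> s * sqrt (x \<bullet> x)"
      unfolding s_def by (rule max_singular_value_bound(2)[OF C N x(1)])
    moreover have "sqrt (((?T + Cp) *\<^sub>v x) \<bullet> ((?T + Cp) *\<^sub>v x)) \<le>
        sqrt ((?T *\<^sub>v x) \<bullet> (?T *\<^sub>v x)) + sqrt ((Cp *\<^sub>v x) \<bullet> (Cp *\<^sub>v x))"
      unfolding eq using T C x by (intro sqrt_scalar_prod_triangle[of _ "n * n"]) auto
    \<comment> \<open>The two factors add up to (\<alpha> - s) + s = \<alpha>.\<close>
    ultimately have "sqrt (((?T + Cp) *\<^sub>v x) \<bullet> ((?T + Cp) *\<^sub>v x)) < \<alpha> * sqrt (x \<bullet> x)"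
      by (simp add: algebra_simps)
    also have "\<dots> = sqrt (\<alpha>\<^sup>2 * (x \<bullet> x))" using assms(6) by (simp add: real_sqrt_mult)
    finally show ?thesis by simp
  qed
  moreover have "?T + Cp \<in> carrier_mat (n * n) (n * n)" using T C by simp
  ultimately show ?thesis
    using spectral_radius_less_if_contracting[OF _ N assms(6)] by (simp add: A_def)
qed

end
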